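(* Consider the scalar system $$\dot x = \theta^{0T}\varphi(t,x) + b\,u ,$$ with tracking error $e = x - x_d$ obeying $\dot e = b(\theta^{T}\varphi(t,x)+u)$, where $\theta=\theta^0/b$, under the controller $$u(t) = -\,\mathrm{sgn}(b)\,\kappa\, e(t) - \hat\theta^{T}(t)\,\varphi(t,x(t)),\qquad t\ge 0,$$ and the adaptation law $$\hat\theta(t) = \begin{cases} \hat\theta(t-\tau) + \mathrm{sgn}(b)\,\gamma\,\varphi(t,x(t))\,e(t), & t\ge 0,\\ \hat\theta_0, & t\in[-\tau,0),\end{cases}$$ where $\tau,\kappa,\gamma>0$ are design parameters and $\hat\theta_0$ is a constant vector (the initial setting for $\hat\theta$). Then, along the trajectories of this closed-loop system on $[0,+\infty)$, $$\lim_{t\to+\infty} e(t)=0,$$ and $e$ and $x$ are bounded on $[0,+\infty)$, and $\int_{t-\tau}^{t}\|\hat\theta(s)\|^2ds$ and $\int_{t-\tau}^{t}u^2(s)\,ds$ are bounded over $t\in[\tau,+\infty)$.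
   Context: $x(t)\in\mathbb{R}$ is the state, $u(t)\in\mathbb{R}$ the input, $\theta^0$ a constant vector of unknown parameters, $\varphi(\cdot,\cdot)$ a vector (of the same dimension as $\theta^0$) of known continuous nonlinearities, and $b\neq 0$ an unknown constant control gain whose sign $\mathrm{sgn}(b)$ is known (it may be positive or negative). A trajectory $x_d(t)$, $t\in[0,+\infty)$, is given, and $e=x-x_d$ is the tracking error. Standing relation of the setting: the error dynamics are $\dot e=b(\theta^T\varphi(t,x)+u)$ with $\theta=\theta^0/b$. $\|\cdot\|$ is the Euclidean norm.
   Formalization: Boundedness of the integral of u² over [t−τ,t] is proved only when φ(t,x) is bounded over t ≥ 0 uniformly for x in bounded sets; for merely continuous φ it fails (e.g. φ = exp t). All other claims hold for every continuous φ. *)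

theory Defs
  imports "HOL-Analysis.Analysis"
begin

definition switch_times :: "real \<Rightarrow> real set" where
  "switch_times \<tau> = range (\<lambda>k::nat. real k * \<tau>)"

(* The adaptation law makes the parameter estimate, and hence the input, jump at the
   multiples of the delay (the jump at time 0 is copied to every later multiple).  A solution of
   the closed loop is therefore a continuous function that satisfies the differential equation
   off these instants; two-sided differentiability at all times would in general fail. *)
definition trajectory_with_rate :: "real \<Rightarrow> (real \<Rightarrow> real) \<Rightarrow> (real \<Rightarrow> real) \<Rightarrow> bool" where
  "trajectory_with_rate \<tau> y f \<longleftrightarrow>
     continuous_on {0..} y \<and>
     (\<forall>t>0. t \<notin> switch_times \<tau> \<longrightarrow> (y has_real_derivative f t) (at t))"

(* Boundedness of the nonlinearity in time, uniformly for the state in bounded sets; joint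
   continuity alone does not bound it as time tends to infinity. *)
definition bounded_on_bounded_states :: "(real \<Rightarrow> real \<Rightarrow> 'a::real_normed_vector) \<Rightarrow> bool" where
  "bounded_on_bounded_states \<phi> \<longleftrightarrow>
     (\<forall>r. bounded {\<phi> t y | t y. t \<ge> 0 \<and> \<bar>y\<bar> \<le> r})"

end

theory Submission
  imports Defs
begin

text \<open>
  Write \<open>p = \<theta> - \<theta>hat\<close> for the parameter error and absorb the sign of the gain into the regressor,
  \<open>w(t) = sgn b \<phi>(t, x(t))\<close>.  The closed loop then reads
  \<open>e' = \<bar>b\<bar> (p \<bullet> w - \<kappa> e)\<close> and \<open>p(t) = p(t - \<tau>) - \<gamma> e(t) w(t)\<close>.
  The functional
  \<open>V(t) = e(t)\<^sup>2 / (2\<bar>b\<bar>) + 1/(2\<gamma>) \<integral>\<^bsub>t-\<tau>\<^esub>\<^bsup>t\<^esup> \<parallel>p\<parallel>\<^sup>2\<close>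
  decreases at the rate \<open>q = \<kappa> e\<^sup>2 + (\<gamma>/2) \<parallel>w\<parallel>\<^sup>2 e\<^sup>2\<close>: the cross term \<open>e (p \<bullet> w)\<close> from the error
  equation is cancelled by the one obtained from expanding \<open>\<parallel>p(t - \<tau>)\<parallel>\<^sup>2 = \<parallel>p(t) + \<gamma> e(t) w(t)\<parallel>\<^sup>2\<close>.
  The estimate jumps at the multiples of \<open>\<tau>\<close>, so this is established in integrated form
  (\<open>energy_balance\<close>); it bounds \<open>e\<close>, the window integrals of \<open>\<parallel>p\<parallel>\<^sup>2\<close>, and the total integral of \<open>q\<close>.

  The regressor may be unbounded in time, so \<open>e'\<close> need not be bounded and Barbalat's lemma is not
  available for the convergence of \<open>e\<close>.  Instead the growth of \<open>e\<^sup>2\<close> is controlled on windows of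
  length at most \<open>\<tau>\<close>: by Young's inequality \<open>e (p \<bullet> w)\<close> is at most a small multiple of
  \<open>\<parallel>p\<parallel>\<^sup>2\<close>, whose window integral is bounded, plus a large multiple of \<open>\<parallel>w\<parallel>\<^sup>2 e\<^sup>2\<close>, whose window
  integral tends to zero (\<open>energy_growth\<close>).  Since \<open>\<integral> e\<^sup>2\<close> over a window also tends to zero,
  \<open>e\<^sup>2\<close> itself does (\<open>tendsto_zero_if_dissipated\<close>).

  The state and the error satisfy the same differential equation, so they differ by a
  constant and the state is bounded as well.  The bound on \<open>\<theta>hat\<close> is that on \<open>p\<close> shifted by \<open>\<theta>\<close>;
  along a bounded state a regressor that is bounded on bounded states is bounded in time,
  so the input inherits its bound from \<open>e\<close> and \<open>\<theta>hat\<close>.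
\<close>

section \<open>Functions continuous between the points of a lattice\<close>

text \<open>
  On each half-open cell the function agrees with one that is continuous on the closed cell.
  This is the regularity that the delayed adaptation law propagates from one cell to the next,
  and the left limits it provides at the cell ends make the function integrable.
\<close>

definition lattice_continuous :: "real \<Rightarrow> real \<Rightarrow> (real \<Rightarrow> 'a::topological_space) \<Rightarrow> bool" where
  "lattice_continuous a \<tau> f \<longleftrightarrow>
     (\<forall>k::nat. \<exists>g. continuous_on {a + real k * \<tau>..a + real (Suc k) * \<tau>} g \<and>
        (\<forall>t\<in>{a + real k * \<tau>..<a + real (Suc k) * \<tau>}. f t = g t))"

lemma lattice_continuous_of_continuous:
  assumes "continuous_on {a..} f" and "\<tau> > 0"
  shows "lattice_continuous a \<tau> f"
  unfolding lattice_continuous_def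
proof
  fix k :: nat
  have "continuous_on {a + real k * \<tau>..a + real (Suc k) * \<tau>} f"
  proof (rule continuous_on_subset[OF assms(1)])
    have "real k * \<tau> \<ge> 0" using assms(2) by simp
    then show "{a + real k * \<tau>..a + real (Suc k) * \<tau>} \<subseteq> {a..}" by auto
  qed
  then show "\<exists>g. continuous_on {a + real k * \<tau>..a + real (Suc k) * \<tau>} g \<and>
        (\<forall>t\<in>{a + real k * \<tau>..<a + real (Suc k) * \<tau>}. f t = g t)" by blast
qed

lemma lattice_continuous_compose2:
  assumes h: "continuous_on UNIV (\<lambda>(y, z). h y z)"
    and f: "lattice_continuous a \<tau> f" and g: "lattice_continuous a \<tau> g"
  shows "lattice_continuous a \<tau> (\<lambda>t. h (f t) (g t))"
  unfolding lattice_continuous_def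
proof
  fix k :: nat
  let ?C = "{a + real k * \<tau>..a + real (Suc k) * \<tau>}"
  let ?H = "{a + real k * \<tau>..<a + real (Suc k) * \<tau>}"
  obtain f' where f': "continuous_on ?C f'" "\<forall>t\<in>?H. f t = f' t"
    using f unfolding lattice_continuous_def by blast
  obtain g' where g': "continuous_on ?C g'" "\<forall>t\<in>?H. g t = g' t"
    using g unfolding lattice_continuous_def by blast
  have "continuous_on ?C (\<lambda>t. (\<lambda>(y, z). h y z) (f' t, g' t))"
    by (rule continuous_on_compose2[OF h]) (use f' g' in \<open>auto intro!: continuous_on_Pair simp del: of_nat_Suc\<close>)
  then have "continuous_on ?C (\<lambda>t. h (f' t) (g' t))" by simp
  moreover have "\<forall>t\<in>?H. h (f t) (g t) = h (f' t) (g' t)" using f' g' by simp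
  ultimately show "\<exists>g'. continuous_on ?C g' \<and> (\<forall>t\<in>?H. h (f t) (g t) = g' t)" by blast
qed

lemma lattice_continuous_shift:
  assumes "lattice_continuous a \<tau> f"
  shows "lattice_continuous (a + \<tau>) \<tau> f"
  unfolding lattice_continuous_def
proof
  fix k :: nat
  have eq: "a + \<tau> + real k * \<tau> = a + real (Suc k) * \<tau>"
    "a + \<tau> + real (Suc k) * \<tau> = a + real (Suc (Suc k)) * \<tau>"
    by (simp_all add: algebra_simps)
  show "\<exists>g. continuous_on {a + \<tau> + real k * \<tau>..a + \<tau> + real (Suc k) * \<tau>} g \<and>
      (\<forall>t\<in>{a + \<tau> + real k * \<tau>..<a + \<tau> + real (Suc k) * \<tau>}. f t = g t)"
    unfolding eq using assms unfolding lattice_continuous_def by blast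
qed

lemma lattice_continuous_integrable:
  fixes f :: "real \<Rightarrow> 'a::banach"
  assumes f: "lattice_continuous a \<tau> f" and "\<tau> > 0" and "a \<le> c"
  shows "f integrable_on {c..d}"
proof -
  have whole: "f integrable_on {a..a + real k * \<tau>}" for k :: nat
  proof (induction k)
    case 0
    show ?case using integrable_on_refl[of f a] by simp
  next
    case (Suc k)
    obtain g where g: "continuous_on {a + real k * \<tau>..a + real (Suc k) * \<tau>} g"
      "\<forall>t\<in>{a + real k * \<tau>..<a + real (Suc k) * \<tau>}. f t = g t"
      using f unfolding lattice_continuous_def by blast
    have "f integrable_on {a + real k * \<tau>..a + real (Suc k) * \<tau>}"
      by (rule integrable_spike_finite[of "{a + real (Suc k) * \<tau>}" _ _ g])
        (use g in \<open>auto intro!: integrable_continuous_real\<close>)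
    moreover have "a \<le> a + real k * \<tau>" "a + real k * \<tau> \<le> a + real (Suc k) * \<tau>"
      using \<open>\<tau> > 0\<close> by (auto simp: algebra_simps)
    ultimately show ?case using Suc Henstock_Kurzweil_Integration.integrable_combine by blast
  qed
  obtain k :: nat where "(d - a) / \<tau> \<le> real k" using real_arch_simple by blast
  then have "d \<le> a + real k * \<tau>" using \<open>\<tau> > 0\<close> by (simp add: field_simps)
  then show ?thesis
    using \<open>a \<le> c\<close> by (intro integrable_subinterval_real[OF whole[of k]]) auto
qed

section \<open>Convergence from dissipation without a bounded derivative\<close>

text \<open>
  A substitute for Barbalat's lemma.  Averaging the growth bound over the starting time \<open>s\<close> in
  \<open>[t - \<tau>, t]\<close> bounds \<open>\<tau> v(t)\<close> by the integral of \<open>v\<close> over the window, plus the growth terms; the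
  integral of \<open>q\<close> over a late window is small, and \<open>\<delta>\<close> is chosen before the window.
\<close>

lemma tendsto_zero_if_dissipated:
  fixes v q :: "real \<Rightarrow> real"
  assumes "\<tau> > 0" and "c > 0"
    and v_nonneg: "\<And>t. t \<ge> 0 \<Longrightarrow> 0 \<le> v t"
    and v_int: "\<And>s t. 0 \<le> s \<Longrightarrow> v integrable_on {s..t}"
    and q_int: "\<And>s t. 0 \<le> s \<Longrightarrow> q integrable_on {s..t}"
    and vq: "\<And>t. t \<ge> 0 \<Longrightarrow> c * v t \<le> q t"
    and total: "\<And>t. t \<ge> 0 \<Longrightarrow> integral {0..t} q \<le> M"
    and growth: "\<And>\<delta> s t. \<lbrakk>\<delta> > 0; 0 \<le> s; s \<le> t; t \<le> s + \<tau>\<rbrakk>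
        \<Longrightarrow> v t - v s \<le> \<delta> * M + integral {s..t} q / \<delta>"
  shows "(v \<longlongrightarrow> 0) at_top"
proof (rule tendstoI)
  fix \<epsilon> :: real
  assume "\<epsilon> > 0"
  have q_nonneg: "0 \<le> q t" if "t \<ge> 0" for t
    using vq[OF that] v_nonneg[OF that] \<open>c > 0\<close> by (meson mult_nonneg_nonneg less_imp_le order_trans)
  define Q where "Q t = integral {0..t} q" for t
  have Q_diff: "integral {s..t} q = Q t - Q s" if "0 \<le> s" "s \<le> t" for s t
    unfolding Q_def using Henstock_Kurzweil_Integration.integral_combine[OF that q_int[of 0 t]] by simp
  have Q_mono: "Q s \<le> Q t" if "0 \<le> s" "s \<le> t" for s t
  proof -
    have "0 \<le> integral {s..t} q"
      using that by (intro integral_nonneg q_int) (auto intro!: q_nonneg)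
    then show ?thesis using Q_diff[OF that] by simp
  qed
  have "M \<ge> 0" using total[of 0] by simp
  define \<delta> where "\<delta> = \<epsilon> / (4 * (M + 1))"
  have "\<delta> > 0" unfolding \<delta>_def using \<open>\<epsilon> > 0\<close> \<open>M \<ge> 0\<close> by simp
  have \<delta>M: "\<delta> * M \<le> \<epsilon> / 4"
    unfolding \<delta>_def using \<open>\<epsilon> > 0\<close> \<open>M \<ge> 0\<close> by (simp add: field_simps)
  define \<eta> where "\<eta> = min (\<epsilon> * \<delta> / 4) (\<epsilon> * c * \<tau> / 4)"
  have "\<eta> > 0" unfolding \<eta>_def using \<open>\<epsilon> > 0\<close> \<open>\<delta> > 0\<close> \<open>c > 0\<close> \<open>\<tau> > 0\<close> by simp
  \<comment> \<open>Beyond a point where the nondecreasing \<open>Q\<close> nearly attains its supremum it grows by less than \<open>\<eta>\<close>.\<close>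
  have bdd: "bdd_above (Q ` {0..})"
    unfolding Q_def using total by (auto intro!: bdd_aboveI[of _ M])
  have "\<exists>y\<in>Q ` {0..}. Sup (Q ` {0..}) - \<eta> < y"
    using \<open>\<eta> > 0\<close> by (intro less_cSupD) auto
  then obtain T where T: "T \<ge> 0" "Sup (Q ` {0..}) - \<eta> < Q T" by auto
  have tail: "integral {s..t} q \<le> \<eta>" if "T \<le> s" "s \<le> t" for s t
  proof -
    have "Q t \<le> Sup (Q ` {0..})" using bdd that T by (intro cSup_upper) auto
    moreover have "Q T \<le> Q s" using that T by (intro Q_mono) auto
    ultimately show ?thesis using Q_diff[of s t] that T by simp
  qed
  have "dist (v t) 0 < \<epsilon>" if t: "t \<ge> T + \<tau>" for t
  proof -
    have pos: "t - \<tau> \<ge> 0" "t \<ge> 0" using t T \<open>\<tau> > 0\<close> by auto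
    have step: "v t - \<delta> * M - \<eta> / \<delta> \<le> v s" if "s \<in> {t - \<tau>..t}" for s
    proof -
      have "v t - v s \<le> \<delta> * M + integral {s..t} q / \<delta>"
        using that pos \<open>\<delta> > 0\<close> by (intro growth) auto
      also have "integral {s..t} q / \<delta> \<le> \<eta> / \<delta>"
        using that t \<open>\<delta> > 0\<close> by (intro divide_right_mono tail) auto
      finally show ?thesis by simp
    qed
    have "c * (\<tau> * (v t - \<delta> * M - \<eta> / \<delta>)) = c * integral {t - \<tau>..t} (\<lambda>s. v t - \<delta> * M - \<eta> / \<delta>)"
      using \<open>\<tau> > 0\<close> by simp
    also have "\<dots> \<le> c * integral {t - \<tau>..t} v"
      using \<open>c > 0\<close> pos by (intro mult_left_mono integral_le v_int integrable_const_ivl step) auto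
    also have "\<dots> = integral {t - \<tau>..t} (\<lambda>s. c * v s)" by simp
    also have "\<dots> \<le> integral {t - \<tau>..t} q"
      using pos v_int by (intro integral_le q_int vq integrable_on_mult_right) auto
    also have "\<dots> \<le> \<eta>" using t \<open>\<tau> > 0\<close> by (intro tail) auto
    also have "\<dots> \<le> c * (\<tau> * (\<epsilon> / 4))" unfolding \<eta>_def by (simp add: mult_ac min_le_iff_disj)
    finally have "v t - \<delta> * M - \<eta> / \<delta> \<le> \<epsilon> / 4" using \<open>c > 0\<close> \<open>\<tau> > 0\<close> by simp
    moreover have "\<eta> / \<delta> \<le> \<epsilon> / 4"
      using \<open>\<delta> > 0\<close> unfolding \<eta>_def by (simp add: pos_divide_le_eq mult_ac min_le_iff_disj)
    ultimately show ?thesis using \<delta>M \<open>\<epsilon> > 0\<close> v_nonneg[OF pos(2)] by (simp add: dist_real_def)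
  qed
  then show "\<forall>\<^sub>F t in at_top. dist (v t) 0 < \<epsilon>"
    unfolding eventually_at_top_linorder by blast
qed

section \<open>Trajectories that are differentiable off the switching times\<close>

lemma finite_switch_times_Icc:
  assumes "\<tau> > 0"
  shows "finite (switch_times \<tau> \<inter> {s..t})"
proof -
  obtain n :: nat where n: "t / \<tau> \<le> real n" using real_arch_simple by blast
  have "switch_times \<tau> \<inter> {s..t} \<subseteq> (\<lambda>k::nat. real k * \<tau>) ` {..n}"
  proof
    fix r assume "r \<in> switch_times \<tau> \<inter> {s..t}"
    then obtain k :: nat where k: "r = real k * \<tau>" "r \<le> t" unfolding switch_times_def by auto
    then have "real k \<le> t / \<tau>" using assms by (simp add: field_simps)
    then have "k \<le> n" using n by linarith
    then show "r \<in> (\<lambda>k::nat. real k * \<tau>) ` {..n}" using k by auto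
  qed
  then show ?thesis by (rule finite_subset) simp
qed

lemma trajectory_has_integral:
  assumes y: "trajectory_with_rate \<tau> y f" and "\<tau> > 0" and "0 \<le> s" "s \<le> t"
  shows "(f has_integral (y t - y s)) {s..t}"
proof (rule fundamental_theorem_of_calculus_interior_strong[OF finite_switch_times_Icc[OF \<open>\<tau> > 0\<close>, of s t]])
  show "(y has_vector_derivative f r) (at r)" if "r \<in> {s<..<t} - switch_times \<tau> \<inter> {s..t}" for r
    using y that \<open>0 \<le> s\<close>
    unfolding trajectory_with_rate_def has_real_derivative_iff_has_vector_derivative[symmetric] by auto
  show "continuous_on {s..t} y"
    using y \<open>0 \<le> s\<close> unfolding trajectory_with_rate_def by (auto intro: continuous_on_subset)
qed fact

lemma trajectories_same_rate:
  assumes "trajectory_with_rate \<tau> y f" and "trajectory_with_rate \<tau> z f"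
    and "\<tau> > 0" and "t \<ge> 0"
  shows "y t - y 0 = z t - z 0"
  by (rule has_integral_unique[OF trajectory_has_integral trajectory_has_integral]) (use assms in auto)

section \<open>The delayed learning loop\<close>

text \<open>
  The closed loop in the coordinates in which the sign of the gain has disappeared: \<open>p\<close> is the
  parameter error, \<open>w\<close> the signed regressor along the trajectory, and \<open>\<beta>\<close> the modulus of the gain.
\<close>

locale delayed_learning_loop =
  fixes e :: "real \<Rightarrow> real" and w p :: "real \<Rightarrow> 'a::real_inner" and p0 :: 'a
    and \<tau> \<kappa> \<gamma> \<beta> :: real
  assumes \<tau>_pos: "\<tau> > 0" and \<kappa>_pos: "\<kappa> > 0" and \<gamma>_pos: "\<gamma> > 0" and \<beta>_pos: "\<beta> > 0"
    and w_cont: "continuous_on {0..} w"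
    and error: "trajectory_with_rate \<tau> e (\<lambda>t. \<beta> * (p t \<bullet> w t - \<kappa> * e t))"
    and update: "\<And>t. t \<ge> 0 \<Longrightarrow> p t = p (t - \<tau>) - (\<gamma> * e t) *\<^sub>R w t"
    and initial: "\<And>t. - \<tau> \<le> t \<Longrightarrow> t < 0 \<Longrightarrow> p t = p0"
begin

lemma e_cont: "continuous_on {0..} e"
  using error unfolding trajectory_with_rate_def by blast

text \<open>Each cell inherits a continuous representative from the previous one through the update law.\<close>

lemma p_lattice_continuous: "lattice_continuous (- \<tau>) \<tau> p"
  unfolding lattice_continuous_def
proof
  fix k :: nat
  show "\<exists>g. continuous_on {- \<tau> + real k * \<tau>..- \<tau> + real (Suc k) * \<tau>} g \<and>
      (\<forall>t\<in>{- \<tau> + real k * \<tau>..<- \<tau> + real (Suc k) * \<tau>}. p t = g t)"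
  proof (induction k)
    case 0
    show ?case by (rule exI[of _ "\<lambda>_. p0"]) (auto intro!: initial)
  next
    case (Suc k)
    then obtain g where g: "continuous_on {- \<tau> + real k * \<tau>..- \<tau> + real (Suc k) * \<tau>} g"
      "\<forall>t\<in>{- \<tau> + real k * \<tau>..<- \<tau> + real (Suc k) * \<tau>}. p t = g t" by blast
    let ?C = "{- \<tau> + real (Suc k) * \<tau>..- \<tau> + real (Suc (Suc k)) * \<tau>}"
    let ?g = "\<lambda>t. g (t - \<tau>) - (\<gamma> * e t) *\<^sub>R w t"
    have nonneg: "t \<ge> 0" if "- \<tau> + real (Suc k) * \<tau> \<le> t" for t
    proof -
      have "0 \<le> real k * \<tau>" using \<tau>_pos by simp
      also have "\<dots> \<le> t" using that by (simp add: algebra_simps)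
      finally show ?thesis .
    qed
    have C_pos: "?C \<subseteq> {0..}"
    proof
      fix t assume "t \<in> ?C"
      then show "t \<in> {0..}" using nonneg[of t] by (simp only: atLeastAtMost_iff atLeast_iff)
    qed
    have shift_C: "(\<lambda>t. t - \<tau>) ` ?C \<subseteq> {- \<tau> + real k * \<tau>..- \<tau> + real (Suc k) * \<tau>}"
    proof (rule image_subsetI)
      fix t assume "t \<in> ?C"
      then show "t - \<tau> \<in> {- \<tau> + real k * \<tau>..- \<tau> + real (Suc k) * \<tau>}"
        by (simp add: algebra_simps)
    qed
    have "continuous_on ?C (\<lambda>t. g (t - \<tau>))"
      by (rule continuous_on_compose2[OF g(1) _ shift_C]) (intro continuous_intros)
    then have "continuous_on ?C ?g"
      by (intro continuous_intros continuous_on_subset[OF e_cont C_pos]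
          continuous_on_subset[OF w_cont C_pos])
    moreover have "\<forall>t\<in>{- \<tau> + real (Suc k) * \<tau>..<- \<tau> + real (Suc (Suc k)) * \<tau>}. p t = ?g t"
    proof
      fix t assume t: "t \<in> {- \<tau> + real (Suc k) * \<tau>..<- \<tau> + real (Suc (Suc k)) * \<tau>}"
      then have "t - \<tau> \<in> {- \<tau> + real k * \<tau>..<- \<tau> + real (Suc k) * \<tau>}"
        by (simp add: algebra_simps)
      then have "p (t - \<tau>) = g (t - \<tau>)" using g(2) by blast
      moreover have "t \<ge> 0" using t by (intro nonneg) (simp only: atLeastLessThan_iff)
      ultimately show "p t = ?g t" by (simp add: update)
    qed
    ultimately show ?case by (intro exI[of _ ?g] conjI)
  qed
qed

lemma p_sq_integrable: "(\<lambda>t. (norm (p t))\<^sup>2) integrable_on {s..t}" if "- \<tau> \<le> s"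
proof -
  have "lattice_continuous (- \<tau>) \<tau> (\<lambda>t. (norm (p t))\<^sup>2)"
    using lattice_continuous_compose2[of "\<lambda>y z. (norm y)\<^sup>2", OF _ p_lattice_continuous p_lattice_continuous]
    by (simp add: case_prod_unfold continuous_intros)
  then show ?thesis using \<tau>_pos that by (rule lattice_continuous_integrable)
qed

definition energy :: "real \<Rightarrow> real" where
  "energy t = (e t)\<^sup>2 / (2 * \<beta>)"

definition dissipation :: "real \<Rightarrow> real" where
  "dissipation t = \<kappa> * (e t)\<^sup>2 + \<gamma> / 2 * (norm (w t))\<^sup>2 * (e t)\<^sup>2"

text \<open>The value at time zero of the functional that the loop dissipates.\<close>

definition initial_energy :: real where
  "initial_energy = energy 0 + integral {- \<tau>..0} (\<lambda>t. (norm (p t))\<^sup>2) / (2 * \<gamma>)"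

lemma energy_nonneg: "energy t \<ge> 0"
  unfolding energy_def using \<beta>_pos by simp

lemma dissipation_nonneg: "dissipation t \<ge> 0"
  unfolding dissipation_def using \<kappa>_pos \<gamma>_pos by simp

lemma dissipation_ge_energy: "2 * \<beta> * \<kappa> * energy t \<le> dissipation t"
  unfolding dissipation_def energy_def using \<beta>_pos \<gamma>_pos by simp

lemma energy_cont: "continuous_on {0..} energy"
  unfolding energy_def[abs_def] using \<beta>_pos e_cont by (intro continuous_intros) auto

lemma dissipation_cont: "continuous_on {0..} dissipation"
  unfolding dissipation_def[abs_def] by (intro continuous_intros e_cont w_cont)

lemma integrable_of_cont:
  assumes "continuous_on {0..} (f :: real \<Rightarrow> real)" and "0 \<le> s"
  shows "f integrable_on {s..t}"
  using assms by (intro integrable_continuous_real continuous_on_subset[OF assms(1)]) auto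

lemma energy_has_integral:
  assumes "0 \<le> s" "s \<le> t"
  shows "((\<lambda>r. e r * (p r \<bullet> w r) - \<kappa> * (e r)\<^sup>2) has_integral (energy t - energy s)) {s..t}"
proof (rule trajectory_has_integral[OF _ \<tau>_pos assms])
  have "(energy has_real_derivative e t * (p t \<bullet> w t) - \<kappa> * (e t)\<^sup>2) (at t)"
    if "t > 0" "t \<notin> switch_times \<tau>" for t
  proof -
    have "(e has_real_derivative \<beta> * (p t \<bullet> w t - \<kappa> * e t)) (at t)"
      using error that unfolding trajectory_with_rate_def by blast
    then show ?thesis
      unfolding energy_def[abs_def] using \<beta>_pos
      by (auto intro!: derivative_eq_intros simp: field_simps power2_eq_square)
  qed
  then show "trajectory_with_rate \<tau> energy (\<lambda>r. e r * (p r \<bullet> w r) - \<kappa> * (e r)\<^sup>2)"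
    unfolding trajectory_with_rate_def using energy_cont by blast
qed

text \<open>
  The update law turns the cross term of the error equation into a difference of the delayed and
  the current parameter error, up to the second part of the dissipation.
\<close>

lemma cross_term:
  assumes "t \<ge> 0"
  shows "e t * (p t \<bullet> w t) - \<kappa> * (e t)\<^sup>2 =
    ((norm (p (t - \<tau>)))\<^sup>2 - (norm (p t))\<^sup>2) / (2 * \<gamma>) - dissipation t"
proof -
  have "p (t - \<tau>) = p t + (\<gamma> * e t) *\<^sub>R w t" using update[OF assms] by simp
  then have "(norm (p (t - \<tau>)))\<^sup>2 =
      (norm (p t))\<^sup>2 + 2 * \<gamma> * e t * (p t \<bullet> w t) + \<gamma>\<^sup>2 * (e t)\<^sup>2 * (norm (w t))\<^sup>2"
    by (simp only: power2_norm_eq_inner) (simp add: inner_simps inner_commute power2_eq_square algebra_simps)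
  then show ?thesis
    unfolding dissipation_def using \<gamma>_pos by (simp add: field_simps power2_eq_square)
qed

text \<open>
  The two sliding windows of \<open>\<parallel>p\<parallel>\<^sup>2\<close> produced by \<open>cross_term\<close> overlap, and what survives of them is
  the initial window and the current one.
\<close>

lemma energy_balance:
  assumes "t \<ge> 0"
  shows "energy t + integral {0..t} dissipation
    + integral {t - \<tau>..t} (\<lambda>r. (norm (p r))\<^sup>2) / (2 * \<gamma>) = initial_energy"
proof -
  let ?N = "\<lambda>r. (norm (p r))\<^sup>2"
  have N: "(?N has_integral integral {0..t} ?N) {0..t}"
    using p_sq_integrable[of 0 t] \<tau>_pos by (simp add: integrable_integral)
  have "(?N has_integral integral {- \<tau>..t - \<tau>} ?N) {- \<tau>..t - \<tau>}"
    using p_sq_integrable[of "- \<tau>" "t - \<tau>"] by (simp add: integrable_integral)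
  from has_integral_shift_real_ivl[OF this, of "- \<tau>"]
  have N': "((\<lambda>r. ?N (r - \<tau>)) has_integral integral {- \<tau>..t - \<tau>} ?N) {0..t}" by simp
  have D: "(dissipation has_integral integral {0..t} dissipation) {0..t}"
    using integrable_of_cont[OF dissipation_cont, of 0 t] by (simp add: integrable_integral)
  have "((\<lambda>r. (?N (r - \<tau>) - ?N r) / (2 * \<gamma>) - dissipation r) has_integral
      (integral {- \<tau>..t - \<tau>} ?N - integral {0..t} ?N) / (2 * \<gamma>) - integral {0..t} dissipation) {0..t}"
    by (intro has_integral_diff has_integral_divide N N' D)
  then have "((\<lambda>r. e r * (p r \<bullet> w r) - \<kappa> * (e r)\<^sup>2) has_integral
      (integral {- \<tau>..t - \<tau>} ?N - integral {0..t} ?N) / (2 * \<gamma>) - integral {0..t} dissipation) {0..t}"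
    by (rule has_integral_eq[rotated]) (simp add: cross_term)
  then have balance: "energy t - energy 0 =
      (integral {- \<tau>..t - \<tau>} ?N - integral {0..t} ?N) / (2 * \<gamma>) - integral {0..t} dissipation"
    using energy_has_integral[OF order_refl assms] has_integral_unique by blast
  have "integral {- \<tau>..0} ?N + integral {0..t} ?N = integral {- \<tau>..t} ?N"
    using assms \<tau>_pos by (intro Henstock_Kurzweil_Integration.integral_combine p_sq_integrable) auto
  moreover have "integral {- \<tau>..t - \<tau>} ?N + integral {t - \<tau>..t} ?N = integral {- \<tau>..t} ?N"
    using assms \<tau>_pos by (intro Henstock_Kurzweil_Integration.integral_combine p_sq_integrable) auto
  ultimately have "integral {- \<tau>..t - \<tau>} ?N - integral {0..t} ?N =
      integral {- \<tau>..0} ?N - integral {t - \<tau>..t} ?N" by linarith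
  with balance show ?thesis unfolding initial_energy_def by (simp add: diff_divide_distrib)
qed

lemma window_nonneg: "integral {t - \<tau>..t} (\<lambda>r. (norm (p r))\<^sup>2) \<ge> 0" if "t \<ge> 0"
  using that by (intro integral_nonneg p_sq_integrable) auto

lemma total_dissipation_nonneg: "integral {0..t} dissipation \<ge> 0"
  by (intro integral_nonneg integrable_of_cont dissipation_cont) (auto simp: dissipation_nonneg)

lemma energy_le: "energy t \<le> initial_energy" if "t \<ge> 0"
  using energy_balance[OF that] window_nonneg[OF that] total_dissipation_nonneg[of t] \<gamma>_pos
  by (smt (verit) divide_nonneg_pos)

lemma total_dissipation_le: "integral {0..t} dissipation \<le> initial_energy" if "t \<ge> 0"
  using energy_balance[OF that] window_nonneg[OF that] energy_nonneg[of t] \<gamma>_pos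
  by (smt (verit) divide_nonneg_pos)

lemma window_le: "integral {t - \<tau>..t} (\<lambda>r. (norm (p r))\<^sup>2) \<le> 2 * \<gamma> * initial_energy" if "t \<ge> 0"
proof -
  have "integral {t - \<tau>..t} (\<lambda>r. (norm (p r))\<^sup>2) / (2 * \<gamma>) \<le> initial_energy"
    using energy_balance[OF that] energy_nonneg[of t] total_dissipation_nonneg[of t] by linarith
  then show ?thesis using \<gamma>_pos by (simp add: field_simps)
qed

text \<open>
  Young's inequality with weight \<open>\<delta>/\<gamma>\<close>; the weight is scaled so that both the bound on the window
  of \<open>\<parallel>p\<parallel>\<^sup>2\<close> and the bound of \<open>\<parallel>w\<parallel>\<^sup>2 e\<^sup>2\<close> by the dissipation lose their factors of \<open>\<gamma>\<close>.
\<close>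

lemma energy_growth:
  assumes "\<delta> > 0" "0 \<le> s" "s \<le> t" "t \<le> s + \<tau>"
  shows "energy t - energy s \<le> \<delta> * initial_energy + integral {s..t} dissipation / \<delta>"
proof -
  let ?N = "\<lambda>r. (norm (p r))\<^sup>2"
  have pointwise: "e r * (p r \<bullet> w r) - \<kappa> * (e r)\<^sup>2 \<le> \<delta> / (2 * \<gamma>) * ?N r + dissipation r / \<delta>" for r
  proof -
    define a where "a = norm (p r)"
    define z where "z = norm (w r) * \<bar>e r\<bar>"
    have "e r * (p r \<bullet> w r) \<le> \<bar>e r\<bar> * \<bar>p r \<bullet> w r\<bar>" by (metis abs_ge_self abs_mult)
    also have "\<dots> \<le> \<bar>e r\<bar> * (norm (p r) * norm (w r))"
      by (intro mult_left_mono Cauchy_Schwarz_ineq2) auto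
    also have "\<dots> = a * z" by (simp add: a_def z_def)
    also have "a * z \<le> \<delta> / (2 * \<gamma>) * a\<^sup>2 + \<gamma> / 2 * z\<^sup>2 / \<delta>"
    proof -
      have "0 \<le> (\<delta> * a - \<gamma> * z)\<^sup>2 / (2 * \<gamma> * \<delta>)" using \<gamma>_pos \<open>\<delta> > 0\<close> by simp
      also have "\<dots> = \<delta> / (2 * \<gamma>) * a\<^sup>2 + \<gamma> / 2 * z\<^sup>2 / \<delta> - a * z"
        using \<gamma>_pos \<open>\<delta> > 0\<close> by (simp add: field_simps power2_eq_square)
      finally show ?thesis by simp
    qed
    also have "\<gamma> / 2 * z\<^sup>2 / \<delta> \<le> dissipation r / \<delta>"
      using \<kappa>_pos \<open>\<delta> > 0\<close>
      by (intro divide_right_mono) (auto simp: dissipation_def z_def power_mult_distrib)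
    finally have "e r * (p r \<bullet> w r) \<le> \<delta> / (2 * \<gamma>) * ?N r + dissipation r / \<delta>"
      by (simp add: a_def)
    moreover have "\<kappa> * (e r)\<^sup>2 \<ge> 0" using \<kappa>_pos by simp
    ultimately show ?thesis by linarith
  qed
  have Nst: "?N integrable_on {s..t}" using assms \<tau>_pos by (intro p_sq_integrable) auto
  have Dst: "dissipation integrable_on {s..t}"
    using assms by (intro integrable_of_cont dissipation_cont)
  have "((\<lambda>r. \<delta> / (2 * \<gamma>) * ?N r + dissipation r / \<delta>) has_integral
      \<delta> / (2 * \<gamma>) * integral {s..t} ?N + integral {s..t} dissipation / \<delta>) {s..t}"
    using Nst Dst
    by (intro has_integral_add has_integral_divide has_integral_mult_right integrable_integral)
  then have "energy t - energy s \<le>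
      \<delta> / (2 * \<gamma>) * integral {s..t} ?N + integral {s..t} dissipation / \<delta>"
    using energy_has_integral[OF assms(2,3)] pointwise has_integral_le by blast
  also have "\<delta> / (2 * \<gamma>) * integral {s..t} ?N \<le> \<delta> / (2 * \<gamma>) * (2 * \<gamma> * initial_energy)"
  proof (intro mult_left_mono)
    have "integral {s..t} ?N \<le> integral {t - \<tau>..t} ?N"
      using assms Nst p_sq_integrable[of "t - \<tau>" t] by (intro integral_subset_le) auto
    also have "\<dots> \<le> 2 * \<gamma> * initial_energy" using assms by (intro window_le) auto
    finally show "integral {s..t} ?N \<le> 2 * \<gamma> * initial_energy" .
  qed (use \<open>\<delta> > 0\<close> \<gamma>_pos in auto)
  also have "\<delta> / (2 * \<gamma>) * (2 * \<gamma> * initial_energy) = \<delta> * initial_energy"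
    using \<gamma>_pos by simp
  finally show ?thesis by simp
qed

theorem error_tendsto_zero: "(e \<longlongrightarrow> 0) at_top"
proof -
  have "(energy \<longlongrightarrow> 0) at_top"
  proof (rule tendsto_zero_if_dissipated[where \<tau> = \<tau> and c = "2 * \<beta> * \<kappa>" and q = dissipation
        and M = initial_energy])
    show "0 < 2 * \<beta> * \<kappa>" using \<beta>_pos \<kappa>_pos by simp
    show "energy integrable_on {s..t}" "dissipation integrable_on {s..t}" if "0 \<le> s" for s t
      using that by (simp_all add: integrable_of_cont energy_cont dissipation_cont)
    show "energy t - energy s \<le> \<delta> * initial_energy + integral {s..t} dissipation / \<delta>"
      if "\<delta> > 0" "0 \<le> s" "s \<le> t" "t \<le> s + \<tau>" for \<delta> s t
      using that by (rule energy_growth)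
  qed (simp_all add: \<tau>_pos energy_nonneg dissipation_ge_energy total_dissipation_le)
  then have "((\<lambda>t. sqrt (2 * \<beta> * energy t)) \<longlongrightarrow> sqrt (2 * \<beta> * 0)) at_top"
    by (intro tendsto_intros)
  moreover have "sqrt (2 * \<beta> * energy t) = \<bar>e t\<bar>" for t
    unfolding energy_def using \<beta>_pos by simp
  ultimately show ?thesis by (simp add: tendsto_rabs_zero_iff)
qed

theorem error_bounded: "bounded (e ` {0..})"
  unfolding bounded_iff
proof (intro exI ballI)
  fix y assume "y \<in> e ` {0..}"
  then obtain t where t: "t \<ge> 0" "y = e t" by auto
  have "(e t)\<^sup>2 \<le> 2 * \<beta> * initial_energy"
    using energy_le[OF t(1)] \<beta>_pos unfolding energy_def by (simp add: field_simps)
  then show "norm y \<le> sqrt (2 * \<beta> * initial_energy)"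
    using t real_le_rsqrt[of "\<bar>e t\<bar>"] by simp
qed

end

theorem theorem1:
  fixes x x\<^sub>d e u :: "real \<Rightarrow> real"
    and \<phi> :: "real \<Rightarrow> real \<Rightarrow> real ^ 'n"
    and \<theta>0 \<theta> \<theta>hat0 :: "real ^ 'n"
    and \<theta>hat :: "real \<Rightarrow> real ^ 'n"
    and b \<tau> \<kappa> \<gamma> :: real
  assumes "b \<noteq> 0" and "\<tau> > 0" and "\<kappa> > 0" and "\<gamma> > 0"
    and "\<theta> = (1 / b) *\<^sub>R \<theta>0"
    and "continuous_on ({0..} \<times> UNIV) (\<lambda>(t, y). \<phi> t y)"
    and "\<And>t. t \<ge> 0 \<Longrightarrow> e t = x t - x\<^sub>d t"
    and "trajectory_with_rate \<tau> x (\<lambda>t. \<theta>0 \<bullet> \<phi> t (x t) + b * u t)"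
    and "trajectory_with_rate \<tau> e (\<lambda>t. b * (\<theta> \<bullet> \<phi> t (x t) + u t))"
    and "\<And>t. t \<ge> 0 \<Longrightarrow> u t = - sgn b * \<kappa> * e t - \<theta>hat t \<bullet> \<phi> t (x t)"
    and "\<And>t. t \<ge> 0 \<Longrightarrow> \<theta>hat t = \<theta>hat (t - \<tau>) + (sgn b * \<gamma> * e t) *\<^sub>R \<phi> t (x t)"
    and "\<And>t. - \<tau> \<le> t \<Longrightarrow> t < 0 \<Longrightarrow> \<theta>hat t = \<theta>hat0"
  shows "(e \<longlongrightarrow> 0) at_top
    \<and> bounded (e ` {0..})
    \<and> bounded (x ` {0..})
    \<and> (\<forall>t\<ge>\<tau>. (\<lambda>s. (norm (\<theta>hat s))\<^sup>2) integrable_on {t - \<tau>..t})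
    \<and> bounded ((\<lambda>t. integral {t - \<tau>..t} (\<lambda>s. (norm (\<theta>hat s))\<^sup>2)) ` {\<tau>..})
    \<and> (\<forall>t\<ge>\<tau>. (\<lambda>s. (u s)\<^sup>2) integrable_on {t - \<tau>..t})
    \<and> (bounded_on_bounded_states \<phi> \<longrightarrow>
         bounded ((\<lambda>t. integral {t - \<tau>..t} (\<lambda>s. (u s)\<^sup>2)) ` {\<tau>..}))"
proof -
  note b = assms(1) and \<tau> = assms(2) and \<kappa> = assms(3) and \<gamma> = assms(4)
  note \<phi>_cont = assms(6) and x_traj = assms(8) and e_traj = assms(9)
    and control = assms(10) and adapt = assms(11) and start = assms(12)
  define \<Phi> where "\<Phi> t = \<phi> t (x t)" for t
  define w where "w t = sgn b *\<^sub>R \<Phi> t" for t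
  define p where "p t = \<theta> - \<theta>hat t" for t
  have sgn_sq: "sgn b * sgn b = 1" and b_sgn: "b = \<bar>b\<bar> * sgn b"
    using b by (auto simp: sgn_if)
  have x_cont: "continuous_on {0..} x"
    using x_traj unfolding trajectory_with_rate_def by blast
  have \<Phi>_cont: "continuous_on {0..} \<Phi>"
  proof -
    have "continuous_on {0..} (\<lambda>t. (\<lambda>(t, y). \<phi> t y) (t, x t))"
      by (rule continuous_on_compose2[OF \<phi>_cont]) (auto intro!: continuous_intros x_cont)
    then show ?thesis unfolding \<Phi>_def[abs_def] by simp
  qed
  interpret loop: delayed_learning_loop e w p "\<theta> - \<theta>hat0" \<tau> \<kappa> \<gamma> "\<bar>b\<bar>"
  proof
    show "continuous_on {0..} w" unfolding w_def[abs_def] by (intro continuous_intros \<Phi>_cont)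
    have rate: "b * (\<theta> \<bullet> \<phi> t (x t) + u t) = \<bar>b\<bar> * (p t \<bullet> w t - \<kappa> * e t)" if "t > 0" for t
    proof -
      have "b * (\<theta> \<bullet> \<phi> t (x t) + u t) = b * (p t \<bullet> \<Phi> t - sgn b * \<kappa> * e t)"
        using control[of t] that by (simp add: p_def \<Phi>_def inner_diff_left)
      also have "\<dots> = \<bar>b\<bar> * (sgn b * (p t \<bullet> \<Phi> t) - (sgn b * sgn b) * \<kappa> * e t)"
        by (subst b_sgn) (simp add: algebra_simps)
      finally show ?thesis unfolding sgn_sq by (simp add: w_def)
    qed
    show "trajectory_with_rate \<tau> e (\<lambda>t. \<bar>b\<bar> * (p t \<bullet> w t - \<kappa> * e t))"
      unfolding trajectory_with_rate_def
    proof (intro conjI allI impI)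
      show "continuous_on {0..} e" using e_traj unfolding trajectory_with_rate_def by blast
      fix t :: real assume t: "t > 0" "t \<notin> switch_times \<tau>"
      then have "(e has_real_derivative b * (\<theta> \<bullet> \<phi> t (x t) + u t)) (at t)"
        using e_traj unfolding trajectory_with_rate_def by blast
      then show "(e has_real_derivative \<bar>b\<bar> * (p t \<bullet> w t - \<kappa> * e t)) (at t)"
        by (simp only: rate[OF t(1)])
    qed
    show "p t = p (t - \<tau>) - (\<gamma> * e t) *\<^sub>R w t" if "t \<ge> 0" for t
      using adapt[OF that] by (simp add: p_def w_def \<Phi>_def mult_ac)
    show "p t = \<theta> - \<theta>hat0" if "- \<tau> \<le> t" "t < 0" for t
      using start[OF that] by (simp add: p_def)
  qed (use b \<tau> \<kappa> \<gamma> in auto)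

  obtain B where B: "\<bar>e t\<bar> \<le> B" if "t \<ge> 0" for t
    using loop.error_bounded unfolding bounded_iff by auto
  \<comment> \<open>The two rates coincide, which makes the reference trajectory constant.\<close>
  have same_rate: "(\<lambda>t. b * (\<theta> \<bullet> \<phi> t (x t) + u t)) = (\<lambda>t. \<theta>0 \<bullet> \<phi> t (x t) + b * u t)"
    using b by (simp add: assms(5) algebra_simps)
  have x_eq: "x t = x 0 - e 0 + e t" if "t \<ge> 0" for t
    using trajectories_same_rate[OF x_traj e_traj[unfolded same_rate] \<tau> that] by simp
  define R where "R = \<bar>x 0 - e 0\<bar> + B"
  have R: "\<bar>x t\<bar> \<le> R" if "t \<ge> 0" for t
    using x_eq[OF that] B[OF that] unfolding R_def by linarith
  then have x_bounded: "bounded (x ` {0..})" unfolding bounded_iff by auto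

  have \<theta>hat_eq: "\<theta>hat t = \<theta> - p t" for t by (simp add: p_def)
  have \<theta>hat_regular: "lattice_continuous (- \<tau>) \<tau> \<theta>hat"
    using lattice_continuous_compose2[of "\<lambda>y z. \<theta> - y", OF _ loop.p_lattice_continuous loop.p_lattice_continuous]
    unfolding \<theta>hat_eq[abs_def] by (simp add: case_prod_unfold continuous_intros)
  have \<theta>hat_sq_int: "(\<lambda>s. (norm (\<theta>hat s))\<^sup>2) integrable_on {t - \<tau>..t}" if "t \<ge> \<tau>" for t
  proof -
    have "lattice_continuous (- \<tau>) \<tau> (\<lambda>t. (norm (\<theta>hat t))\<^sup>2)"
      using lattice_continuous_compose2[of "\<lambda>y z. (norm y)\<^sup>2", OF _ \<theta>hat_regular \<theta>hat_regular]
      by (simp add: case_prod_unfold continuous_intros)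
    then show ?thesis using that \<tau> by (intro lattice_continuous_integrable) auto
  qed
  define K where "K = 2 * (norm \<theta>)\<^sup>2 * \<tau> + 2 * (2 * \<gamma> * loop.initial_energy)"
  have \<theta>hat_window: "integral {t - \<tau>..t} (\<lambda>s. (norm (\<theta>hat s))\<^sup>2) \<le> K" if "t \<ge> \<tau>" for t
  proof -
    have p_int: "(\<lambda>s. (norm (p s))\<^sup>2) integrable_on {t - \<tau>..t}"
      using that \<tau> by (intro loop.p_sq_integrable) auto
    have pointwise: "(norm (\<theta>hat s))\<^sup>2 \<le> 2 * (norm \<theta>)\<^sup>2 + 2 * (norm (p s))\<^sup>2" for s
    proof -
      have "(norm (\<theta>hat s))\<^sup>2 \<le> (norm \<theta> + norm (p s))\<^sup>2"
        unfolding \<theta>hat_eq by (intro power_mono norm_triangle_ineq4) auto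
      also have "\<dots> \<le> 2 * (norm \<theta>)\<^sup>2 + 2 * (norm (p s))\<^sup>2"
        using sum_squares_bound[of "norm \<theta>" "norm (p s)"] by (simp add: power2_sum)
      finally show ?thesis .
    qed
    have "integral {t - \<tau>..t} (\<lambda>s. (norm (\<theta>hat s))\<^sup>2)
        \<le> integral {t - \<tau>..t} (\<lambda>s. 2 * (norm \<theta>)\<^sup>2 + 2 * (norm (p s))\<^sup>2)"
      using that p_int pointwise
      by (intro integral_le \<theta>hat_sq_int integrable_add integrable_const_ivl integrable_on_mult_right) auto
    also have "\<dots> = 2 * (norm \<theta>)\<^sup>2 * \<tau> + 2 * integral {t - \<tau>..t} (\<lambda>s. (norm (p s))\<^sup>2)"
      using p_int \<tau> by (subst integral_add) (auto intro!: integrable_on_mult_right)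
    also have "\<dots> \<le> K" unfolding K_def using loop.window_le[of t] that \<tau> by simp
    finally show ?thesis .
  qed
  have \<theta>hat_bounded: "bounded ((\<lambda>t. integral {t - \<tau>..t} (\<lambda>s. (norm (\<theta>hat s))\<^sup>2)) ` {\<tau>..})"
    unfolding bounded_iff
    using \<theta>hat_window \<theta>hat_sq_int by (auto intro!: exI[of _ K] simp: integral_nonneg)

  have u_sq_int: "(\<lambda>s. (u s)\<^sup>2) integrable_on {t - \<tau>..t}" if "t \<ge> \<tau>" for t
  proof -
    have \<theta>hat0: "lattice_continuous 0 \<tau> \<theta>hat"
      using lattice_continuous_shift[OF \<theta>hat_regular] by simp
    have "lattice_continuous 0 \<tau> (\<lambda>t. (- sgn b * \<kappa> * e t, \<Phi> t))"
      using \<tau> by (intro lattice_continuous_of_continuous continuous_intros loop.e_cont \<Phi>_cont) auto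
    moreover have "continuous_on UNIV (\<lambda>(y :: real ^ 'n, c :: real, z). (c - y \<bullet> z)\<^sup>2)"
      by (auto simp: case_prod_unfold intro!: continuous_intros)
    ultimately have "lattice_continuous 0 \<tau> (\<lambda>t. (- sgn b * \<kappa> * e t - \<theta>hat t \<bullet> \<Phi> t)\<^sup>2)"
      using lattice_continuous_compose2[of "\<lambda>y (c, z). (c - y \<bullet> z)\<^sup>2", OF _ \<theta>hat0] by fastforce
    then have "(\<lambda>t. (- sgn b * \<kappa> * e t - \<theta>hat t \<bullet> \<Phi> t)\<^sup>2) integrable_on {t - \<tau>..t}"
      using that \<tau> by (intro lattice_continuous_integrable[of 0 \<tau>]) auto
    then show ?thesis
      by (rule integrable_eq) (use that control in \<open>auto simp: \<Phi>_def\<close>)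
  qed
  have u_bounded: "bounded ((\<lambda>t. integral {t - \<tau>..t} (\<lambda>s. (u s)\<^sup>2)) ` {\<tau>..})"
    if \<phi>_bounded: "bounded_on_bounded_states \<phi>"
  proof -
    obtain F where F: "norm (\<phi> t y) \<le> F" if "t \<ge> 0" "\<bar>y\<bar> \<le> R" for t y
      using \<phi>_bounded unfolding bounded_on_bounded_states_def bounded_iff by blast
    have pointwise: "(u s)\<^sup>2 \<le> 2 * \<kappa>\<^sup>2 * B\<^sup>2 + 2 * F\<^sup>2 * (norm (\<theta>hat s))\<^sup>2" if "s \<ge> 0" for s
    proof -
      have "\<bar>u s\<bar> \<le> \<bar>sgn b * \<kappa> * e s\<bar> + \<bar>\<theta>hat s \<bullet> \<Phi> s\<bar>"
        using control[OF that] unfolding \<Phi>_def by simp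
      also have "\<bar>sgn b * \<kappa> * e s\<bar> = \<kappa> * \<bar>e s\<bar>" using b \<kappa> by (simp add: abs_mult abs_sgn_eq)
      also have "\<kappa> * \<bar>e s\<bar> \<le> \<kappa> * B" using \<kappa> B[OF that] by simp
      also have "\<bar>\<theta>hat s \<bullet> \<Phi> s\<bar> \<le> norm (\<theta>hat s) * norm (\<Phi> s)" by (rule Cauchy_Schwarz_ineq2)
      also have "\<dots> \<le> norm (\<theta>hat s) * F"
        unfolding \<Phi>_def using that R by (intro mult_left_mono F) auto
      finally have "\<bar>u s\<bar> \<le> \<kappa> * B + norm (\<theta>hat s) * F" by simp
      then have "\<bar>u s\<bar>\<^sup>2 \<le> (\<kappa> * B + norm (\<theta>hat s) * F)\<^sup>2" by (intro power_mono) auto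
      also have "\<dots> \<le> 2 * (\<kappa> * B)\<^sup>2 + 2 * (norm (\<theta>hat s) * F)\<^sup>2"
        using sum_squares_bound[of "\<kappa> * B" "norm (\<theta>hat s) * F"] by (simp add: power2_sum)
      finally show ?thesis by (simp add: power_mult_distrib mult_ac)
    qed
    have "integral {t - \<tau>..t} (\<lambda>s. (u s)\<^sup>2) \<le> 2 * \<kappa>\<^sup>2 * B\<^sup>2 * \<tau> + 2 * F\<^sup>2 * K" if "t \<ge> \<tau>" for t
    proof -
      have "integral {t - \<tau>..t} (\<lambda>s. (u s)\<^sup>2)
          \<le> integral {t - \<tau>..t} (\<lambda>s. 2 * \<kappa>\<^sup>2 * B\<^sup>2 + 2 * F\<^sup>2 * (norm (\<theta>hat s))\<^sup>2)"
        using that pointwise \<theta>hat_sq_int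
        by (intro integral_le u_sq_int integrable_add integrable_const_ivl integrable_on_mult_right) auto
      also have "\<dots> = 2 * \<kappa>\<^sup>2 * B\<^sup>2 * \<tau> + 2 * F\<^sup>2 * integral {t - \<tau>..t} (\<lambda>s. (norm (\<theta>hat s))\<^sup>2)"
        using \<theta>hat_sq_int[OF that] \<tau> by (subst integral_add) (auto intro!: integrable_on_mult_right)
      also have "\<dots> \<le> 2 * \<kappa>\<^sup>2 * B\<^sup>2 * \<tau> + 2 * F\<^sup>2 * K"
        using \<theta>hat_window[OF that] by (intro add_left_mono mult_left_mono) auto
      finally show ?thesis .
    qed
    then show ?thesis
      unfolding bounded_iff using u_sq_int
      by (auto intro!: exI[of _ "2 * \<kappa>\<^sup>2 * B\<^sup>2 * \<tau> + 2 * F\<^sup>2 * K"] simp: integral_nonneg)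
  qed
  show ?thesis
    using loop.error_tendsto_zero loop.error_bounded x_bounded \<theta>hat_sq_int \<theta>hat_bounded
      u_sq_int u_bounded by blast
qed

end
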